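(* Let $(x_k)$ be a Schauder basic sequence in $c_0$. Viewed as a sequence in $\ell_\infty$, $(x_k)$ is bibasic with unique order expansions.
   Context: A sequence $(x_k)$ of non-zero vectors in a Banach lattice $X$ is bibasic if there is $M\ge1$ with $\bigl\|\bigvee_{n=1}^m|\sum_{k=1}^n\alpha_kx_k|\bigr\|\le M\bigl\|\sum_{k=1}^m\alpha_kx_k\bigr\|$ for all $m\in\mathbb N$ and all scalars $\alpha_1,\dots,\alpha_m$; equivalently, it is Schauder basic and for every norm convergent series $\sum_k\alpha_kx_k$ the partial sums converge in order in $X$ to the same sum. A sequence $(z_n)$ converges in order to $z$ in $X$ if there is a net $(u_\gamma)$ in $X$ with $u_\gamma\downarrow0$ such that for every $\gamma$ there is $n_0$ with $|z_n-z|\le u_\gamma$ for all $n\ge n_0$. The sequence $(x_k)$ has unique order expansions in $X$ if, whenever $\sum_{k=1}^n\alpha_kx_k$ and $\sum_{k=1}^n\beta_kx_k$ converge in order in $X$ (as $n\to\infty$) to the same vector, $\alpha_k=\beta_k$ for every $k$. Here these notions are taken with $X=\ell_\infty$. *)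

theory Defs
  imports "HOL-Analysis.Analysis" "HOL-Library.Lattice_Algebras"
begin

section \<open>Banach lattices\<close>

class banach_lattice = banach + ordered_real_vector + lattice_ab_group_add_abs +
  assumes norm_le_of_abs_le: "\<bar>x\<bar> \<le> \<bar>y\<bar> \<Longrightarrow> norm x \<le> norm y"

instance real :: banach_lattice
  by standard simp

lemma norm_abs_eq: "norm \<bar>x\<bar> = norm (x :: 'a::banach_lattice)"
  by (intro antisym norm_le_of_abs_le) simp_all

lemma sup_diff_le:
  fixes a b c d :: "'a::banach_lattice"
  shows "sup a b \<le> sup c d + (\<bar>a - c\<bar> + \<bar>b - d\<bar>)"
proof (rule sup_least)
  have "a = c + (a - c)" by simp
  also have "\<dots> \<le> sup c d + (\<bar>a - c\<bar> + \<bar>b - d\<bar>)"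
    by (rule add_mono[OF sup_ge1 order_trans[OF abs_ge_self]]) simp
  finally show "a \<le> sup c d + (\<bar>a - c\<bar> + \<bar>b - d\<bar>)" .
  have "b = d + (b - d)" by simp
  also have "\<dots> \<le> sup c d + (\<bar>a - c\<bar> + \<bar>b - d\<bar>)"
    by (rule add_mono[OF sup_ge2 order_trans[OF abs_ge_self]]) simp
  finally show "b \<le> sup c d + (\<bar>a - c\<bar> + \<bar>b - d\<bar>)" .
qed

lemma norm_sup_diff_le:
  fixes a b c d :: "'a::banach_lattice"
  shows "norm (sup a b - sup c d) \<le> norm (a - c) + norm (b - d)"
proof -
  let ?D = "\<bar>a - c\<bar> + \<bar>b - d\<bar>"
  have "sup a b - sup c d \<le> ?D"
    using sup_diff_le[of a b c d] by (simp only: diff_le_eq add.commute)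
  moreover have "- (sup a b - sup c d) \<le> ?D"
    using sup_diff_le[of c d a b]
    by (simp only: minus_diff_eq diff_le_eq add.commute[of _ "sup a b"] abs_minus_commute)
  ultimately have "\<bar>sup a b - sup c d\<bar> \<le> \<bar>?D\<bar>"
    by (meson abs_ge_self abs_leI order_trans)
  then have "norm (sup a b - sup c d) \<le> norm ?D"
    by (rule norm_le_of_abs_le)
  also have "\<dots> \<le> norm \<bar>a - c\<bar> + norm \<bar>b - d\<bar>"
    by (rule norm_triangle_ineq)
  finally show ?thesis
    by (simp add: norm_abs_eq)
qed

lemma continuous_on_sup_lattice:
  fixes f g :: "'b::topological_space \<Rightarrow> 'a::banach_lattice"
  assumes "continuous_on S f" "continuous_on S g"
  shows "continuous_on S (\<lambda>x. sup (f x) (g x))"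
  unfolding continuous_on_def
proof
  fix x assume "x \<in> S"
  then have f: "(f \<longlongrightarrow> f x) (at x within S)" and g: "(g \<longlongrightarrow> g x) (at x within S)"
    using assms by (auto simp: continuous_on_def)
  have "((\<lambda>y. norm (f y - f x) + norm (g y - g x)) \<longlongrightarrow> 0) (at x within S)"
    using tendsto_add[OF tendsto_norm_zero[OF LIM_zero[OF f]] tendsto_norm_zero[OF LIM_zero[OF g]]]
    by simp
  then have "((\<lambda>y. sup (f y) (g y) - sup (f x) (g x)) \<longlongrightarrow> 0) (at x within S)"
    by (rule Lim_null_comparison[rotated]) (intro always_eventually allI norm_sup_diff_le)
  then show "((\<lambda>y. sup (f y) (g y)) \<longlongrightarrow> sup (f x) (g x)) (at x within S)"
    by (rule LIM_zero_cancel)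
qed

lemma sup_cont:
  fixes f g :: "'b::topological_space \<Rightarrow> 'a::banach_lattice"
  assumes "f \<in> bcontfun" "g \<in> bcontfun"
  shows "(\<lambda>x. sup (f x) (g x)) \<in> bcontfun"
proof -
  obtain B C where "\<And>x. norm (f x) \<le> B" "\<And>x. norm (g x) \<le> C"
    using assms unfolding bcontfun_def bounded_iff by auto
  then have "norm (sup (f x) (g x)) \<le> B + C" for x
    using norm_sup_diff_le[of "f x" "g x" 0 0] add_mono[of "norm (f x)" B "norm (g x)" C] by simp
  moreover have "continuous_on UNIV (\<lambda>x. sup (f x) (g x))"
    using assms by (auto simp: bcontfun_def intro: continuous_on_sup_lattice)
  ultimately show ?thesis
    by (intro bcontfun_normI)
qed

lemma inf_cont:
  fixes f g :: "'b::topological_space \<Rightarrow> 'a::banach_lattice"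
  assumes "f \<in> bcontfun" "g \<in> bcontfun"
  shows "(\<lambda>x. inf (f x) (g x)) \<in> bcontfun"
  using uminus_cont[OF sup_cont[OF uminus_cont[OF assms(1)] uminus_cont[OF assms(2)]]]
  by (simp add: neg_sup_eq_inf)

unbundle bcontfun.lifting

instantiation bcontfun :: (topological_space, banach_lattice) lattice_ab_group_add_abs
begin

lift_definition less_eq_bcontfun :: "('a \<Rightarrow>\<^sub>C 'b) \<Rightarrow> ('a \<Rightarrow>\<^sub>C 'b) \<Rightarrow> bool"
  is "\<lambda>f g. \<forall>x. f x \<le> g x" .

definition less_bcontfun :: "('a \<Rightarrow>\<^sub>C 'b) \<Rightarrow> ('a \<Rightarrow>\<^sub>C 'b) \<Rightarrow> bool"
  where "less_bcontfun f g \<longleftrightarrow> f \<le> g \<and> \<not> g \<le> f"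

lift_definition sup_bcontfun :: "('a \<Rightarrow>\<^sub>C 'b) \<Rightarrow> ('a \<Rightarrow>\<^sub>C 'b) \<Rightarrow> 'a \<Rightarrow>\<^sub>C 'b"
  is "\<lambda>f g x. sup (f x) (g x)"
  by (rule sup_cont)

lift_definition inf_bcontfun :: "('a \<Rightarrow>\<^sub>C 'b) \<Rightarrow> ('a \<Rightarrow>\<^sub>C 'b) \<Rightarrow> 'a \<Rightarrow>\<^sub>C 'b"
  is "\<lambda>f g x. inf (f x) (g x)"
  by (rule inf_cont)

definition abs_bcontfun :: "('a \<Rightarrow>\<^sub>C 'b) \<Rightarrow> 'a \<Rightarrow>\<^sub>C 'b"
  where "abs_bcontfun f = sup f (- f)"

instance
proof
  fix f g h :: "'a \<Rightarrow>\<^sub>C 'b"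
  show "f < g \<longleftrightarrow> f \<le> g \<and> \<not> g \<le> f" by (rule less_bcontfun_def)
  show "f \<le> f" by transfer simp
  show "f \<le> h" if "f \<le> g" "g \<le> h" using that by transfer (meson order_trans)
  show "f = g" if "f \<le> g" "g \<le> f" using that by transfer (meson antisym ext)
  show "f \<le> sup f g" "g \<le> sup f g" "inf f g \<le> f" "inf f g \<le> g"
    by (transfer; simp)+
  show "sup g h \<le> f" if "g \<le> f" "h \<le> f" using that by transfer simp
  show "f \<le> inf g h" if "f \<le> g" "f \<le> h" using that by transfer simp
  show "h + f \<le> h + g" if "f \<le> g" using that by transfer simp
  show "\<bar>f\<bar> = sup f (- f)" by (rule abs_bcontfun_def)
qed

end

lemma apply_bcontfun_abs [simp]: "apply_bcontfun \<bar>f\<bar> x = \<bar>apply_bcontfun f x\<bar>"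
  by (simp add: abs_bcontfun_def sup_bcontfun.rep_eq abs_lattice)

instance bcontfun :: (topological_space, banach_lattice) ordered_real_vector
proof
  fix f g :: "'a \<Rightarrow>\<^sub>C 'b" and a b :: real
  show "a *\<^sub>R f \<le> a *\<^sub>R g" if "f \<le> g" "0 \<le> a"
    using that by transfer (simp add: scaleR_left_mono)
  show "a *\<^sub>R f \<le> b *\<^sub>R f" if "a \<le> b" "0 \<le> f"
    using that by transfer (simp add: scaleR_right_mono)
qed

text \<open>
  The library has completeness only over a metric domain, which excludes \<open>nat\<close>.
\<close>

instance bcontfun :: (topological_space, complete_space) complete_space
proof
  fix f :: "nat \<Rightarrow> ('a, 'b) bcontfun"
  assume "Cauchy f"
  then obtain g where "uniform_limit UNIV f g sequentially"
    using uniformly_convergent_eq_cauchy[of "\<lambda>_. True" f]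
    unfolding Cauchy_def uniform_limit_sequentially_iff
    by (metis dist_fun_lt_imp_dist_val_lt)
  from uniform_limit_bcontfunE[OF this sequentially_bot]
  obtain l' where "g = apply_bcontfun l'" "(f \<longlonglongrightarrow> l')" by metis
  then show "convergent f"
    by (intro convergentI)
qed

instance bcontfun :: (topological_space, banach) banach ..

instance bcontfun :: (topological_space, banach_lattice) banach_lattice
proof
  fix f g :: "'a \<Rightarrow>\<^sub>C 'b"
  assume "\<bar>f\<bar> \<le> \<bar>g\<bar>"
  then have "\<bar>apply_bcontfun f x\<bar> \<le> \<bar>apply_bcontfun g x\<bar>" for x
    by (simp add: less_eq_bcontfun.rep_eq)
  then have "norm (apply_bcontfun f x) \<le> norm g" for x
    by (meson norm_le_of_abs_le norm_bounded order_trans)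
  then show "norm f \<le> norm g"
    by (rule norm_bound)
qed


section \<open>Sequences in Banach lattices\<close>

text \<open>
  Sequences are indexed from \<open>0\<close>, so the partial sum with \<open>n\<close> terms is the sum over \<open>k < n\<close>.
\<close>

definition schauder_basis :: "'a::banach set \<Rightarrow> (nat \<Rightarrow> 'a) \<Rightarrow> bool"
  where "schauder_basis S x \<longleftrightarrow>
    range x \<subseteq> S \<and> (\<forall>v\<in>S. \<exists>!\<alpha> :: nat \<Rightarrow> real. (\<lambda>k. \<alpha> k *\<^sub>R x k) sums v)"

definition schauder_basic :: "(nat \<Rightarrow> 'a::banach) \<Rightarrow> bool"
  where "schauder_basic x \<longleftrightarrow> schauder_basis (closure (span (range x))) x"

definition bibasic :: "(nat \<Rightarrow> 'a::banach_lattice) \<Rightarrow> bool"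
  where "bibasic x \<longleftrightarrow> (\<forall>k. x k \<noteq> 0) \<and>
    (\<exists>M\<ge>1. \<forall>m\<ge>1. \<forall>\<alpha> :: nat \<Rightarrow> real.
      norm (Sup_fin ((\<lambda>n. \<bar>\<Sum>k<n. \<alpha> k *\<^sub>R x k\<bar>) ` {1..m})) \<le> M * norm (\<Sum>k<m. \<alpha> k *\<^sub>R x k))"

text \<open>
  \<open>net_decreasing_to_0 I r u\<close>: \<open>I\<close> is a non-empty set directed by the preorder \<open>r\<close>, and
  \<open>(u i)\<close>, \<open>i \<in> I\<close>, is a decreasing net with infimum \<open>0\<close>.
\<close>

definition net_decreasing_to_0 ::
    "'i set \<Rightarrow> ('i \<Rightarrow> 'i \<Rightarrow> bool) \<Rightarrow> ('i \<Rightarrow> 'a::banach_lattice) \<Rightarrow> bool"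
  where "net_decreasing_to_0 I r u \<longleftrightarrow>
    I \<noteq> {} \<and>
    (\<forall>i\<in>I. r i i) \<and>
    (\<forall>i\<in>I. \<forall>j\<in>I. \<forall>k\<in>I. r i j \<longrightarrow> r j k \<longrightarrow> r i k) \<and>
    (\<forall>i\<in>I. \<forall>j\<in>I. \<exists>k\<in>I. r i k \<and> r j k) \<and>
    (\<forall>i\<in>I. \<forall>j\<in>I. r i j \<longrightarrow> u j \<le> u i) \<and>
    (\<forall>i\<in>I. 0 \<le> u i) \<and>
    (\<forall>w. (\<forall>i\<in>I. w \<le> u i) \<longrightarrow> w \<le> 0)"

text \<open>
  HOL cannot quantify over the index type of the net, so the index set is taken inside \<open>'a\<close>.
  This loses nothing: a decreasing net on any index set can be replaced by its range, directed by
  \<open>\<ge>\<close> (lemma \<open>order_converges_toI\<close> below).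
\<close>

definition order_converges_to :: "(nat \<Rightarrow> 'a::banach_lattice) \<Rightarrow> 'a \<Rightarrow> bool"
  where "order_converges_to z l \<longleftrightarrow>
    (\<exists>(I :: 'a set) r u. net_decreasing_to_0 I r u \<and>
      (\<forall>i\<in>I. \<exists>n\<^sub>0. \<forall>n\<ge>n\<^sub>0. \<bar>z n - l\<bar> \<le> u i))"

lemma order_converges_toI:
  fixes I :: "'i set" and u :: "'i \<Rightarrow> 'a::banach_lattice"
  assumes "net_decreasing_to_0 I r u"
    and "\<And>i. i \<in> I \<Longrightarrow> \<exists>n\<^sub>0. \<forall>n\<ge>n\<^sub>0. \<bar>z n - l\<bar> \<le> u i"
  shows "order_converges_to z l"
proof -
  have "\<exists>k\<in>I. u k \<le> u i \<and> u k \<le> u j" if "i \<in> I" "j \<in> I" for i j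
    using assms(1) that unfolding net_decreasing_to_0_def by meson
  moreover have "I \<noteq> {}" "\<forall>i\<in>I. 0 \<le> u i" "\<forall>w. (\<forall>i\<in>I. w \<le> u i) \<longrightarrow> w \<le> 0"
    using assms(1) unfolding net_decreasing_to_0_def by blast+
  ultimately have "net_decreasing_to_0 (u ` I) (\<ge>) (\<lambda>v. v)"
    unfolding net_decreasing_to_0_def by (simp add: order_trans[rotated])
  moreover have "\<forall>v\<in>u ` I. \<exists>n\<^sub>0. \<forall>n\<ge>n\<^sub>0. \<bar>z n - l\<bar> \<le> v"
    using assms(2) by simp
  ultimately show ?thesis
    unfolding order_converges_to_def by (intro exI conjI)
qed

definition unique_order_expansions :: "(nat \<Rightarrow> 'a::banach_lattice) \<Rightarrow> bool"
  where "unique_order_expansions x \<longleftrightarrow>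
    (\<forall>(\<alpha> :: nat \<Rightarrow> real) (\<beta> :: nat \<Rightarrow> real) v.
      order_converges_to (\<lambda>n. \<Sum>k<n. \<alpha> k *\<^sub>R x k) v \<longrightarrow>
      order_converges_to (\<lambda>n. \<Sum>k<n. \<beta> k *\<^sub>R x k) v \<longrightarrow>
      (\<forall>k. \<alpha> k = \<beta> k))"


section \<open>The spaces \<open>\<ell>\<^sub>\<infinity>\<close> and \<open>c\<^sub>0\<close>\<close>

text \<open>
  Since \<open>nat\<close> is discrete, every bounded real sequence is a bounded continuous function on it.
\<close>

type_synonym linf = "nat \<Rightarrow>\<^sub>C real"

lemma linf_carrier: "(bcontfun :: (nat \<Rightarrow> real) set) = {f. bounded (range f)}"
  by (auto simp: bcontfun_def)

definition c0 :: "linf set"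
  where "c0 = {f. apply_bcontfun f \<longlonglongrightarrow> 0}"

text \<open>
  As \<open>c\<^sub>0\<close> is a closed subspace, the closed linear span of a sequence in \<open>c\<^sub>0\<close> is the same whether
  it is formed in \<open>c\<^sub>0\<close> or in \<open>\<ell>\<^sub>\<infinity>\<close>.
\<close>

lemma subspace_c0: "subspace c0"
proof (rule subspaceI)
  show "0 \<in> c0" by (simp add: c0_def)
next
  fix f g assume "f \<in> c0" "g \<in> c0"
  then show "f + g \<in> c0" using tendsto_add[of f 0 sequentially g 0] by (simp add: c0_def)
next
  fix a f assume "f \<in> c0"
  then show "a *\<^sub>R f \<in> c0" using tendsto_mult_left[of f 0 sequentially a] by (simp add: c0_def)
qed

lemma closed_c0: "closed c0"
  unfolding closed_sequential_limits
proof safe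
  fix f and l :: linf
  assume f: "\<forall>n. f n \<in> c0" and l: "f \<longlonglongrightarrow> l"
  have "(apply_bcontfun l \<longlongrightarrow> 0) sequentially"
  proof (rule swap_uniform_limit'[where f = "\<lambda>n. apply_bcontfun (f n)" and g = "\<lambda>_. 0" and F = sequentially])
    show "\<forall>\<^sub>F n in sequentially. (apply_bcontfun (f n) \<longlongrightarrow> 0) sequentially"
      using f by (simp add: c0_def)
    show "uniform_limit UNIV (\<lambda>n. apply_bcontfun (f n)) (apply_bcontfun l) sequentially"
      by (rule tendsto_bcontfun_uniform_limit[OF l])
  qed simp_all
  then show "l \<in> c0" by (simp add: c0_def)
qed

lemma closure_span_subset_c0: "range x \<subseteq> c0 \<Longrightarrow> closure (span (range x)) \<subseteq> c0"
  by (intro closure_minimal span_minimal subspace_c0 closed_c0)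

end

theory Submission
  imports Defs
begin

text \<open>
  By Baire's theorem and successive approximation the basis projections are uniformly bounded, and
  in \<open>\<ell>\<^sub>\<infinity>\<close> the norm of a finite supremum of moduli is the maximum of the norms; this gives the
  bibasic inequality. For uniqueness, the difference of two order expansions has partial sums
  \<open>t\<^sub>n \<in> c\<^sub>0\<close> that are bounded and tend to \<open>0\<close> coordinatewise. A gliding hump argument makes
  averages of suitable \<open>t\<^sub>n\<close> with arbitrarily large indices small in norm, and a basis projection of
  such an average is a fixed partial sum, which must therefore vanish.
\<close>

section \<open>The basis constant\<close>

abbreviation partial_sum :: "(nat \<Rightarrow> 'a::real_vector) \<Rightarrow> (nat \<Rightarrow> real) \<Rightarrow> nat \<Rightarrow> 'a"
  where "partial_sum x \<alpha> n \<equiv> \<Sum>k<n. \<alpha> k *\<^sub>R x k"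

lemma partial_sum_diff: "partial_sum x (\<lambda>k. \<alpha> k - \<beta> k) n = partial_sum x \<alpha> n - partial_sum x \<beta> n"
  by (simp add: scaleR_left_diff_distrib sum_subtractf)

lemma partial_sum_scale: "partial_sum x (\<lambda>k. c * \<alpha> k) n = c *\<^sub>R partial_sum x \<alpha> n"
  by (simp add: scaleR_sum_right)

text \<open>For a basis this is the ball of radius \<open>K\<close> for the norm sup_n ||P_n v||,
  with P_n the basis projections. The existential form allows sums and multiples to be treated
  without coefficient functionals.\<close>

definition bounded_expansions :: "(nat \<Rightarrow> 'a::real_normed_vector) \<Rightarrow> real \<Rightarrow> 'a set"
  where "bounded_expansions x K =
    {v. \<exists>\<alpha>. (\<lambda>k. \<alpha> k *\<^sub>R x k) sums v \<and> (\<forall>n. norm (partial_sum x \<alpha> n) \<le> K)}"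

lemma bounded_expansionsI:
  assumes "(\<lambda>k. \<alpha> k *\<^sub>R x k) sums v" "\<And>n. norm (partial_sum x \<alpha> n) \<le> K"
  shows "v \<in> bounded_expansions x K"
  using assms unfolding bounded_expansions_def by blast

lemma bounded_expansionsE:
  assumes "v \<in> bounded_expansions x K"
  obtains \<alpha> where "(\<lambda>k. \<alpha> k *\<^sub>R x k) sums v" "\<And>n. norm (partial_sum x \<alpha> n) \<le> K"
  using assms unfolding bounded_expansions_def by blast

lemma bounded_expansions_diff:
  assumes "v \<in> bounded_expansions x K" "w \<in> bounded_expansions x L"
  shows "v - w \<in> bounded_expansions x (K + L)"
proof -
  obtain \<alpha> \<beta> where a: "(\<lambda>k. \<alpha> k *\<^sub>R x k) sums v" "\<And>n. norm (partial_sum x \<alpha> n) \<le> K"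
    and b: "(\<lambda>k. \<beta> k *\<^sub>R x k) sums w" "\<And>n. norm (partial_sum x \<beta> n) \<le> L"
    by (rule bounded_expansionsE[OF assms(1)], rule bounded_expansionsE[OF assms(2)]) blast
  have "norm (partial_sum x (\<lambda>k. \<alpha> k - \<beta> k) n) \<le> K + L" for n
    unfolding partial_sum_diff by (rule order_trans[OF norm_triangle_ineq4 add_mono[OF a(2) b(2)]])
  moreover have "(\<lambda>k. (\<alpha> k - \<beta> k) *\<^sub>R x k) sums (v - w)"
    using sums_diff[OF a(1) b(1)] by (simp add: scaleR_left_diff_distrib)
  ultimately show ?thesis
    by (intro bounded_expansionsI)
qed

lemma bounded_expansions_scale:
  assumes "v \<in> bounded_expansions x K"
  shows "c *\<^sub>R v \<in> bounded_expansions x (\<bar>c\<bar> * K)"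
proof -
  obtain \<alpha> where a: "(\<lambda>k. \<alpha> k *\<^sub>R x k) sums v" "\<And>n. norm (partial_sum x \<alpha> n) \<le> K"
    by (rule bounded_expansionsE[OF assms]) blast
  have "norm (partial_sum x (\<lambda>k. c * \<alpha> k) n) \<le> \<bar>c\<bar> * K" for n
    unfolding partial_sum_scale by (simp add: a(2) mult_left_mono)
  moreover have "(\<lambda>k. (c * \<alpha> k) *\<^sub>R x k) sums (c *\<^sub>R v)"
    using sums_scaleR_right[OF a(1), of c] by simp
  ultimately show ?thesis
    by (intro bounded_expansionsI)
qed

text \<open>A convergent series has bounded partial sums. The bound is rounded up to a natural
  number so that countably many sets cover the space, as Baire's theorem requires.\<close>

lemma bounded_expansions_of_sums:
  assumes "(\<lambda>k. \<alpha> k *\<^sub>R x k) sums v"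
  shows "\<exists>K::nat. v \<in> bounded_expansions x K"
proof -
  have "Bseq (partial_sum x \<alpha>)"
    using assms unfolding sums_def by (meson convergentI convergent_imp_Bseq)
  then obtain B where "\<And>n. norm (partial_sum x \<alpha> n) \<le> B"
    unfolding Bseq_def by blast
  then have "norm (partial_sum x \<alpha> n) \<le> real (nat \<lceil>B\<rceil>)" for n
    by (meson order_trans real_nat_ceiling_ge)
  with assms show ?thesis
    by (blast intro: bounded_expansionsI)
qed

section \<open>Baire category and successive approximation in a closed subspace\<close>

lemma expansion_in_closed_subspace:
  fixes x :: "nat \<Rightarrow> 'a::real_normed_vector"
  assumes "closed S" "subspace S" "range x \<subseteq> S" "(\<lambda>k. \<alpha> k *\<^sub>R x k) sums v"
  shows "v \<in> S"
proof (rule closed_sequentially[OF assms(1)])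
  show "partial_sum x \<alpha> n \<in> S" for n
    using assms(2,3) by (auto intro!: subspace_sum subspace_scale)
  show "partial_sum x \<alpha> \<longlonglongrightarrow> v"
    using assms(4) by (simp add: sums_def)
qed

text \<open>By Baire, the closure of some \<open>bounded_expansions x K\<close> contains a ball of
  \<open>S\<close>. Differences move the ball to the origin and scaling reaches every
  \<open>w\<close>. Only the closure is controlled so far, hence an approximation, whose relative
  error 1/2 suits iteration.\<close>

lemma approximation_by_bounded_expansions:
  fixes x :: "nat \<Rightarrow> 'a::banach"
  assumes S: "closed S" "subspace S" "range x \<subseteq> S"
    and ex: "\<And>v. v \<in> S \<Longrightarrow> \<exists>\<alpha>. (\<lambda>k. \<alpha> k *\<^sub>R x k) sums v"
  shows "\<exists>D\<ge>0. \<forall>w\<in>S. \<exists>a\<in>bounded_expansions x (D * norm w). norm (w - a) \<le> norm w / 2"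
proof -
  let ?A = "\<lambda>K. bounded_expansions x K"
  have A_S: "?A K \<subseteq> S" for K
  proof
    fix v assume "v \<in> ?A K"
    then show "v \<in> S"
      by (rule bounded_expansionsE) (rule expansion_in_closed_subspace[OF S])
  qed
  have clo: "closure (?A K) \<subseteq> S" for K
    by (rule closure_minimal[OF A_S S(1)])
  have "S \<subseteq> (\<Union>K::nat. closure (?A K))"
  proof
    fix v assume "v \<in> S"
    with ex obtain K :: nat where "v \<in> ?A K"
      using bounded_expansions_of_sums by blast
    then show "v \<in> (\<Union>K::nat. closure (?A K))"
      using closure_subset by blast
  qed
  with clo have un: "(\<Union>K::nat. closure (?A K)) = S"
    by blast
  \<comment> \<open>\<open>S\<close> is completely metrizable, being closed in a Banach space. If
    all these closed sets had empty interior in \<open>S\<close>, so would their union, which is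
    \<open>S\<close> and contains 0.\<close>
  have "\<exists>K::nat. top_of_set S interior_of closure (?A K) \<noteq> {}"
  proof (rule ccontr)
    assume none: "\<not> ?thesis"
    have "completely_metrizable_space (top_of_set S)"
      using S(1) by (metis closed_closedin completely_metrizable_space_closedin
          completely_metrizable_space_euclidean)
    then have "top_of_set S interior_of \<Union>(range (\<lambda>K::nat. closure (?A K))) = {}"
      using none clo by (intro Baire_category_alt) (auto simp: closed_subset)
    then show False
      using un subspace_0[OF S(2)] interior_of_topspace[of "top_of_set S"] by auto
  qed
  then obtain K :: nat and T v where T: "openin (top_of_set S) T" "v \<in> T" "T \<subseteq> closure (?A K)"
    by (auto simp: interior_of_def)
  then obtain r where r: "r > 0" "ball v r \<inter> S \<subseteq> closure (?A K)"
    by (meson openin_contains_ball order_trans)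
  have vS: "v \<in> S"
    using T clo by blast
  \<comment> \<open>Both \<open>v + w\<close> and \<open>v\<close> lie in the closure of
    \<open>?A K\<close>; subtracting approximants cancels the centre \<open>v\<close> at the price
    of doubling the bound.\<close>
  have near: "\<exists>a\<in>?A (real K + real K). norm (w - a) \<le> e" if "w \<in> S" "norm w < r" "e > 0" for w e
  proof -
    have "v + w \<in> closure (?A K)"
      using that r vS S(2) by (auto simp: dist_norm subspace_add)
    then obtain p where p: "p \<in> ?A K" "dist p (v + w) < e / 2"
      using \<open>e > 0\<close> closure_approachable half_gt_zero by blast
    obtain q where q: "q \<in> ?A K" "dist q v < e / 2"
      using T \<open>e > 0\<close> closure_approachable half_gt_zero by (metis subsetD)
    have "w - (p - q) = (q - v) - (p - (v + w))"
      by simp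
    then have "norm (w - (p - q)) \<le> norm (q - v) + norm (p - (v + w))"
      by (metis norm_triangle_ineq4)
    also have "\<dots> \<le> e"
      using p q by (simp add: dist_norm)
    finally show ?thesis
      using bounded_expansions_diff[OF p(1) q(1)] by (rule bexI)
  qed
  show ?thesis
  \<comment> \<open>Scale \<open>w\<close> to norm \<open>r / 2\<close> and approximate within
    \<open>r / 4\<close> with bound \<open>2 * K\<close>. Scaling back by
    \<open>2 * norm w / r\<close> gives error \<open>norm w / 2\<close> and bound
    \<open>4 * K / r * norm w\<close>.\<close>
  proof (intro exI[of _ "4 * K / r"] conjI ballI)
    show "0 \<le> 4 * K / r"
      using r(1) by simp
  next
    fix w assume w: "w \<in> S"
    show "\<exists>a\<in>?A (4 * K / r * norm w). norm (w - a) \<le> norm w / 2"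
    proof (cases "w = 0")
      case True
      then show ?thesis
        unfolding bounded_expansions_def by (auto intro!: exI[of _ "\<lambda>_. 0"])
    next
      case False
      define c where "c = r / (2 * norm w)"
      have c: "c > 0" "inverse c = 2 * norm w / r"
        using False r(1) by (auto simp: c_def)
      have "norm (c *\<^sub>R w) < r"
        using False r(1) by (simp add: c_def)
      moreover have "c *\<^sub>R w \<in> S"
        by (simp add: S(2) w subspace_scale)
      moreover have "r / 4 > 0"
        using r(1) by simp
      ultimately obtain a where a: "a \<in> ?A (real K + real K)" "norm (c *\<^sub>R w - a) \<le> r / 4"
        using near by blast
      have "w - inverse c *\<^sub>R a = inverse c *\<^sub>R (c *\<^sub>R w - a)"
        using c(1) by (simp add: scaleR_right_diff_distrib)
      then have "norm (w - inverse c *\<^sub>R a) = inverse c * norm (c *\<^sub>R w - a)"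
        using c(1) by simp
      also have "\<dots> \<le> inverse c * (r / 4)"
        using a(2) c(1) by simp
      also have "\<dots> = norm w / 2"
        using c(2) r(1) by simp
      finally have "norm (w - inverse c *\<^sub>R a) \<le> norm w / 2" .
      moreover have "\<bar>inverse c\<bar> * (real K + real K) = 4 * K / r * norm w"
        unfolding c(2) using r(1) by simp
      ultimately show ?thesis
        using bounded_expansions_scale[OF a(1), of "inverse c"] by (metis bexI)
    qed
  qed
qed

text \<open>The expansions are added coefficientwise. The summable bounds make the partial sums
  converge uniformly in \<open>n\<close>, so the limit over the terms of the outer series and the
  limit over \<open>n\<close> may be exchanged.\<close>

lemma expansion_of_series_of_expansions:
  fixes x a :: "nat \<Rightarrow> 'a::banach"
  assumes nz: "\<And>k. x k \<noteq> 0"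
    and a: "\<And>j. a j \<in> bounded_expansions x (B j)"
    and B: "summable B"
    and w: "a sums w"
  shows "w \<in> bounded_expansions x (suminf B)"
proof -
  obtain \<alpha> where \<alpha>: "\<And>j. (\<lambda>k. \<alpha> j k *\<^sub>R x k) sums a j"
    and bd: "\<And>j n. norm (partial_sum x (\<alpha> j) n) \<le> B j"
    using a unfolding bounded_expansions_def mem_Collect_eq by metis
  have sm: "summable (\<lambda>j. \<alpha> j k)" for k
  proof (rule summable_comparison_test')
    show "summable (\<lambda>j. 2 * B j / norm (x k))"
      by (intro summable_divide summable_mult B)
    fix j
    \<comment> \<open>This difference is \<open>\<alpha> j k *\<^sub>R x k\<close>, so dividing by
      the non-zero norm of \<open>x k\<close> bounds the coefficient.\<close>
    have "norm (partial_sum x (\<alpha> j) (Suc k) - partial_sum x (\<alpha> j) k) \<le> B j + B j"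
      by (rule order_trans[OF norm_triangle_ineq4 add_mono[OF bd bd]])
    then show "norm (\<alpha> j k) \<le> 2 * B j / norm (x k)"
      using nz[of k] by (simp add: field_simps)
  qed
  define \<beta> where "\<beta> k = (\<Sum>j. \<alpha> j k)" for k
  have Q: "(\<lambda>j. partial_sum x (\<alpha> j) n) sums partial_sum x \<beta> n" for n
    unfolding \<beta>_def by (intro sums_sum sums_scaleR_left summable_sums sm)
  have "norm (partial_sum x \<beta> n) \<le> suminf B" for n
  proof -
    have s: "summable (\<lambda>j. norm (partial_sum x (\<alpha> j) n))"
      by (rule summable_comparison_test'[OF B]) (simp add: bd)
    show ?thesis
      using summable_norm[OF s] suminf_le[OF bd s B] Q[of n] by (simp add: sums_iff)
  qed
  moreover have "partial_sum x \<beta> \<longlonglongrightarrow> w"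
  proof (rule swap_uniform_limit')
    show "\<forall>\<^sub>F J in sequentially. ((\<lambda>n. \<Sum>j<J. partial_sum x (\<alpha> j) n) \<longlongrightarrow> (\<Sum>j<J. a j)) sequentially"
      by (intro always_eventually allI tendsto_sum \<alpha>[unfolded sums_def])
    show "(\<lambda>J. \<Sum>j<J. a j) \<longlonglongrightarrow> w"
      using w by (simp add: sums_def)
    have "uniform_limit UNIV (\<lambda>J n. \<Sum>j<J. partial_sum x (\<alpha> j) n)
        (\<lambda>n. \<Sum>j. partial_sum x (\<alpha> j) n) sequentially"
      by (rule Weierstrass_m_test[OF bd B])
    then show "uniform_limit UNIV (\<lambda>J n. \<Sum>j<J. partial_sum x (\<alpha> j) n)
        (partial_sum x \<beta>) sequentially"
      using Q by (simp add: sums_iff)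
  qed simp_all
  ultimately show ?thesis
    by (intro bounded_expansionsI) (auto simp: sums_def)
qed

section \<open>Uniqueness of coefficients and the basis constant\<close>

lemma schauder_basis_unique:
  assumes "schauder_basis S x" "v \<in> S" "(\<lambda>k. \<alpha> k *\<^sub>R x k) sums v" "(\<lambda>k. \<beta> k *\<^sub>R x k) sums v"
  shows "\<alpha> = \<beta>"
proof -
  have ex1: "\<exists>!\<alpha>. (\<lambda>k. \<alpha> k *\<^sub>R x k) sums v"
    using assms(1,2) unfolding schauder_basis_def by (elim conjE bspec)
  let ?P = "\<lambda>\<alpha>. (\<lambda>k. \<alpha> k *\<^sub>R x k) sums v"
  show ?thesis
    using the1_equality[of ?P, OF ex1 assms(3)] the1_equality[of ?P, OF ex1 assms(4)] by simp
qed

text \<open>If \<open>x k\<close> vanished, its coefficient could be changed freely, and 0 would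
  have two expansions.\<close>

lemma schauder_basis_nonzero:
  assumes "schauder_basis S x" "0 \<in> S"
  shows "x k \<noteq> 0"
proof
  assume "x k = 0"
  then have "(\<lambda>j. (if j = k then 1 else 0) *\<^sub>R x j) sums 0"
    by (smt (verit) scaleR_zero_left scaleR_zero_right sums_cong sums_zero)
  moreover have "(\<lambda>j. 0 *\<^sub>R x j) sums 0"
    by simp
  ultimately have "(\<lambda>j. if j = k then 1 else 0 :: real) = (\<lambda>j. 0)"
    by (rule schauder_basis_unique[OF assms])
  then show False
    by (auto dest: fun_cong[of _ _ k])
qed

text \<open>As in the open mapping theorem: approximate \<open>w\<close>, then the remainder, and so
  on. The remainders halve, the approximants sum to \<open>w\<close>, and their bounds form a
  geometric series with sum \<open>2 * D * norm w\<close>.\<close>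

lemma schauder_basis_bounded_expansions:
  fixes x :: "nat \<Rightarrow> 'a::banach"
  assumes S: "closed S" "subspace S" and x: "schauder_basis S x"
  shows "\<exists>D\<ge>0. \<forall>w\<in>S. w \<in> bounded_expansions x (D * norm w)"
proof -
  have r: "range x \<subseteq> S" and ex: "\<And>v. v \<in> S \<Longrightarrow> \<exists>\<alpha>. (\<lambda>k. \<alpha> k *\<^sub>R x k) sums v"
    using x unfolding schauder_basis_def by blast+
  obtain D where D: "D \<ge> 0"
    and appr: "\<And>w. w \<in> S \<Longrightarrow> \<exists>a\<in>bounded_expansions x (D * norm w). norm (w - a) \<le> norm w / 2"
    using approximation_by_bounded_expansions[OF S r ex] by blast
  obtain h where h: "\<And>w. w \<in> S \<Longrightarrow> h w \<in> bounded_expansions x (D * norm w)"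
    "\<And>w. w \<in> S \<Longrightarrow> norm (w - h w) \<le> norm w / 2"
    using appr by metis
  have h_S: "h w \<in> S" if w: "w \<in> S" for w
    by (rule bounded_expansionsE[OF h(1)[OF w]]) (rule expansion_in_closed_subspace[OF S r])
  have "w \<in> bounded_expansions x (2 * D * norm w)" if "w \<in> S" for w
  proof -
    \<comment> \<open>\<open>u j\<close> is the remainder after \<open>j\<close> approximations and
      \<open>h (u j)\<close> the next approximant, so the series of approximants telescopes.\<close>
    define u where "u j = ((\<lambda>v. v - h v) ^^ j) w" for j
    have u_S: "u j \<in> S" for j
      by (induction j) (auto simp: u_def that intro!: subspace_diff S h_S)
    have u_Suc: "u (Suc j) = u j - h (u j)" for j
      by (simp add: u_def)
    have u_le: "norm (u j) \<le> norm w * (1/2) ^ j" for j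
    proof (induction j)
      case (Suc j)
      then show ?case
        using h(2)[OF u_S[of j]] by (simp add: u_Suc)
    qed (simp add: u_def)
    have "u \<longlonglongrightarrow> 0"
    proof (rule Lim_null_comparison)
      show "\<forall>\<^sub>F j in sequentially. norm (u j) \<le> norm w * (1/2) ^ j"
        by (simp add: u_le)
      show "(\<lambda>j. norm w * (1/2) ^ j) \<longlonglongrightarrow> 0"
        by (intro tendsto_mult_right_zero LIMSEQ_power_zero) simp
    qed
    then have "(\<lambda>j. u j - u (Suc j)) sums (u 0 - 0)"
      by (rule telescope_sums')
    then have sm: "(\<lambda>j. h (u j)) sums w"
      by (simp add: u_Suc) (simp add: u_def)
    have B: "(\<lambda>j. D * (norm w * (1/2) ^ j)) sums (D * (norm w * 2))"
      using geometric_sums[of "1/2 :: real"] by (intro sums_mult) simp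
    have "h (u j) \<in> bounded_expansions x (D * (norm w * (1/2) ^ j))" for j
      using h(1)[OF u_S[of j]] mult_left_mono[OF u_le[of j] D]
      by (elim bounded_expansionsE) (blast intro: bounded_expansionsI order_trans)
    from expansion_of_series_of_expansions[OF schauder_basis_nonzero[OF x subspace_0[OF S(2)]] this
        sums_summable[OF B] sm]
    show ?thesis
      using B by (simp add: sums_iff mult_ac)
  qed
  then show ?thesis
    using D by (intro exI[of _ "2 * D"]) simp
qed

lemma subspace_closure:
  fixes S :: "'a::real_normed_vector set"
  assumes "subspace S"
  shows "subspace (closure S)"
proof (rule subspaceI)
  show "0 \<in> closure S"
    using subspace_0[OF assms] closure_subset by blast
next
  fix v w assume "v \<in> closure S" "w \<in> closure S"
  then obtain f g where "\<And>n. f n \<in> S" "f \<longlonglongrightarrow> v" "\<And>n. g n \<in> S" "g \<longlonglongrightarrow> w"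
    unfolding closure_sequential by blast
  then show "v + w \<in> closure S"
    unfolding closure_sequential
    by (intro exI[of _ "\<lambda>n. f n + g n"]) (auto intro!: tendsto_add subspace_add assms)
next
  fix c v assume "v \<in> closure S"
  then obtain f where "\<And>n. f n \<in> S" "f \<longlonglongrightarrow> v"
    unfolding closure_sequential by blast
  then show "c *\<^sub>R v \<in> closure S"
    unfolding closure_sequential
    by (intro exI[of _ "\<lambda>n. c *\<^sub>R f n"]) (auto intro!: tendsto_scaleR subspace_scale assms)
qed

text \<open>A finite sum lies in the closed span, so it has a bounded expansion there. By uniqueness
  this is the given one cut off at \<open>m\<close>, whose partial sums up to \<open>m\<close> are
  the original ones.\<close>

lemma schauder_basic_basis_constant:
  fixes x :: "nat \<Rightarrow> 'a::banach"
  assumes "schauder_basic x"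
  shows "\<exists>M\<ge>1. \<forall>\<alpha> m n. n \<le> m \<longrightarrow> norm (partial_sum x \<alpha> n) \<le> M * norm (partial_sum x \<alpha> m)"
proof -
  let ?S = "closure (span (range x))"
  have x: "schauder_basis ?S x"
    using assms by (simp add: schauder_basic_def)
  obtain D where D: "D \<ge> 0" "\<And>w. w \<in> ?S \<Longrightarrow> w \<in> bounded_expansions x (D * norm w)"
    using schauder_basis_bounded_expansions[OF closed_closure subspace_closure[OF subspace_span] x]
    by blast
  \<comment> \<open>The maximum with 1 secures the condition \<open>M \<ge> 1\<close> in the
    definition of a bibasic sequence.\<close>
  have "norm (partial_sum x \<alpha> n) \<le> max 1 D * norm (partial_sum x \<alpha> m)" if "n \<le> m" for \<alpha> m n
  proof -
    let ?w = "partial_sum x \<alpha> m"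
    have w: "?w \<in> ?S"
      by (rule subsetD[OF closure_subset]) (intro span_sum span_scale span_base rangeI)
    obtain \<beta> where \<beta>: "(\<lambda>k. \<beta> k *\<^sub>R x k) sums ?w"
      "\<And>n. norm (partial_sum x \<beta> n) \<le> D * norm ?w"
      by (rule bounded_expansionsE[OF D(2)[OF w]]) blast
    have "(\<lambda>k. (if k < m then \<alpha> k else 0) *\<^sub>R x k) sums ?w"
      using sums_If_finite_set[of "{..<m}" "\<lambda>k. \<alpha> k *\<^sub>R x k"]
      by (simp add: if_distrib[of "\<lambda>c. c *\<^sub>R _"] cong: if_cong)
    with x w \<beta>(1) have "\<beta> = (\<lambda>k. if k < m then \<alpha> k else 0)"
      by (rule schauder_basis_unique)
    then have "partial_sum x \<beta> n = partial_sum x \<alpha> n"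
      using that by (intro sum.cong) auto
    with \<beta>(2)[of n] have "norm (partial_sum x \<alpha> n) \<le> D * norm ?w"
      by simp
    also have "\<dots> \<le> max 1 D * norm ?w"
      by (intro mult_right_mono) auto
    finally show ?thesis .
  qed
  then show ?thesis
    by (intro exI[of _ "max 1 D"]) auto
qed


section \<open>Order and norm in \<open>\<ell>\<^sub>\<infinity>\<close>\<close>

text \<open>The ball of radius \<open>c\<close> is an order interval: every modulus lies below the
  constant function \<open>c\<close>, hence so does their supremum.\<close>

lemma norm_Sup_fin_abs_le:
  fixes F :: "linf set"
  assumes "finite F" "F \<noteq> {}" "\<And>f. f \<in> F \<Longrightarrow> norm f \<le> c"
  shows "norm (Sup_fin (abs ` F)) \<le> c"
proof (rule norm_bound)
  fix p
  let ?s = "Sup_fin (abs ` F)"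
  obtain f where f: "f \<in> F"
    using assms(2) by blast
  have "0 \<le> \<bar>f\<bar>"
    by simp
  also have "\<bar>f\<bar> \<le> ?s"
    using f assms(1) by (intro Sup_fin.coboundedI) auto
  finally have lo: "0 \<le> apply_bcontfun ?s p"
    by (simp add: less_eq_bcontfun.rep_eq)
  have "\<bar>g\<bar> \<le> const_bcontfun c" if "g \<in> F" for g
    unfolding less_eq_bcontfun.rep_eq const_bcontfun.rep_eq
    using assms(3)[OF that] norm_bounded[of g] by (auto intro: order_trans)
  then have "?s \<le> const_bcontfun c"
    using assms by (intro Sup_fin.boundedI) auto
  then have "apply_bcontfun ?s p \<le> c"
    by (simp add: less_eq_bcontfun.rep_eq const_bcontfun.rep_eq)
  with lo show "norm (apply_bcontfun ?s p) \<le> c"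
    by simp
qed

text \<open>Infimum 0 of the dominating net is inherited by each coordinate, because multiples of
  coordinate indicators are available as lower bounds. A single member of the net bounds a tail in
  norm.\<close>

lemma order_converges_to_linf:
  fixes z :: "nat \<Rightarrow> linf"
  assumes "order_converges_to z l"
  shows order_converges_to_coordinatewise: "(\<lambda>n. apply_bcontfun (z n) p) \<longlonglongrightarrow> apply_bcontfun l p"
    and order_converges_to_bounded: "\<exists>C. \<forall>\<^sub>F n in sequentially. norm (z n - l) \<le> C"
proof -
  obtain I :: "linf set" and r u where net: "net_decreasing_to_0 I r u"
    and ev: "\<And>i. i \<in> I \<Longrightarrow> \<exists>n0. \<forall>n\<ge>n0. \<bar>z n - l\<bar> \<le> u i"
    using assms unfolding order_converges_to_def by blast
  have I: "I \<noteq> {}" "\<And>i. i \<in> I \<Longrightarrow> 0 \<le> u i" "\<And>w. (\<And>i. i \<in> I \<Longrightarrow> w \<le> u i) \<Longrightarrow> w \<le> 0"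
    using net unfolding net_decreasing_to_0_def by blast+
  have small: "\<exists>i\<in>I. apply_bcontfun (u i) p < e" if "e > 0" for e
  proof (rule ccontr)
    assume none: "\<not> ?thesis"
    \<comment> \<open>\<open>e\<close> times the indicator of \<open>p\<close>: if no
      \<open>u i\<close> dropped below \<open>e\<close> at \<open>p\<close>, this would be a lower
      bound of the net that is not below 0.\<close>
    define f where "f q = (if q = p then e else 0)" for q
    have "f \<in> bcontfun"
      using finite_subset[of "range f" "{0, e}"]
      by (auto simp: linf_carrier f_def intro!: finite_imp_bounded)
    then have ap: "apply_bcontfun (Bcontfun f) = f"
      by (rule Bcontfun_inverse)
    have "Bcontfun f \<le> u i" if "i \<in> I" for i
      using none that I(2)[OF that] by (auto simp: less_eq_bcontfun.rep_eq ap f_def not_less)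
    then have "Bcontfun f \<le> 0"
      by (rule I(3))
    then have "f p \<le> 0"
      by (simp add: less_eq_bcontfun.rep_eq ap)
    with \<open>e > 0\<close> show False
      by (simp add: f_def)
  qed
  show "(\<lambda>n. apply_bcontfun (z n) p) \<longlonglongrightarrow> apply_bcontfun l p"
  proof (rule LIMSEQ_I)
    fix e :: real assume "e > 0"
    then obtain i where i: "i \<in> I" "apply_bcontfun (u i) p < e"
      using small by blast
    then obtain n0 where "\<forall>n\<ge>n0. \<bar>z n - l\<bar> \<le> u i"
      using ev by blast
    with i(2) show "\<exists>n0. \<forall>n\<ge>n0. norm (apply_bcontfun (z n) p - apply_bcontfun l p) < e"
      unfolding less_eq_bcontfun.rep_eq by (auto intro!: exI[of _ n0] order.strict_trans1[OF _ i(2)])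
  qed
  obtain i n0 where "\<forall>n\<ge>n0. \<bar>z n - l\<bar> \<le> u i" "0 \<le> u i"
    using I ev by blast
  then have "norm (z n - l) \<le> norm (u i)" if "n \<ge> n0" for n
    using that by (intro norm_le_of_abs_le) (simp add: abs_of_nonneg)
  then show "\<exists>C. \<forall>\<^sub>F n in sequentially. norm (z n - l) \<le> C"
    unfolding eventually_sequentially by blast
qed

text \<open>Each new \<open>t n\<close> is chosen small on the first \<open>P\<close> coordinates,
  beyond which the sum so far is already below \<open>e\<close>. At every coordinate one of the two
  is below \<open>e\<close>, so each step costs \<open>e\<close> instead of
  \<open>C\<close>.\<close>

lemma gliding_hump_c0:
  fixes t :: "nat \<Rightarrow> linf" and e :: real
  assumes c0: "\<And>n. t n \<in> c0"
    and lim: "\<And>p. (\<lambda>n. apply_bcontfun (t n) p) \<longlonglongrightarrow> 0"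
    and bd: "\<forall>\<^sub>F n in sequentially. norm (t n) \<le> C"
    and e: "e > 0"
  shows "\<exists>F. finite F \<and> card F = N \<and> F \<subseteq> {m..} \<and> norm (sum t F) \<le> C + N * e"
proof (induction N)
  case 0
  obtain n where "norm (t n) \<le> C"
    using bd unfolding eventually_sequentially by blast
  then have "0 \<le> C"
    using norm_ge_zero order_trans by blast
  then show ?case
    by (intro exI[of _ "{}"]) auto
next
  case (Suc N)
  then obtain F where F: "finite F" "card F = N" "F \<subseteq> {m..}" "norm (sum t F) \<le> C + N * e"
    by blast
  have "sum t F \<in> c0"
    using c0 by (intro subspace_sum subspace_c0)
  then obtain P where P: "\<And>p. p \<ge> P \<Longrightarrow> \<bar>apply_bcontfun (sum t F) p\<bar> < e"
    unfolding c0_def using e LIMSEQ_D[of "apply_bcontfun (sum t F)" 0 e] by auto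
  have "\<forall>\<^sub>F n in sequentially. \<forall>p\<in>{..<P}. \<bar>apply_bcontfun (t n) p\<bar> < e"
    by (intro eventually_ball_finite ballI order_tendstoD(2)[OF tendsto_rabs_zero[OF lim] e]) simp
  \<comment> \<open>The index must stay at least \<open>m\<close> and be new to \<open>F\<close>;
    inserting 0 keeps \<open>Max\<close> meaningful when \<open>F\<close> is empty.\<close>
  moreover have "\<forall>\<^sub>F n in sequentially. n \<ge> max m (Suc (Max (insert 0 F)))"
    by (rule eventually_ge_at_top)
  ultimately have "\<forall>\<^sub>F n in sequentially. norm (t n) \<le> C \<and>
      (\<forall>p\<in>{..<P}. \<bar>apply_bcontfun (t n) p\<bar> < e) \<and> n \<ge> max m (Suc (Max (insert 0 F)))"
    using bd by (intro eventually_conj)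
  then obtain n where n: "norm (t n) \<le> C" "\<And>p. p < P \<Longrightarrow> \<bar>apply_bcontfun (t n) p\<bar> < e"
    "n \<ge> m" "n > Max (insert 0 F)"
    by (auto dest!: eventually_happens'[OF sequentially_bot] simp del: Max_insert)
  have "n \<notin> F"
    using n(4) F(1) Max_ge[of "insert 0 F" n] by auto
  have "norm (sum t (insert n F)) \<le> C + Suc N * e"
  proof (rule norm_bound)
    fix p
    have ge: "\<bar>apply_bcontfun (sum t F) p\<bar> \<le> C + N * e" "\<bar>apply_bcontfun (t n) p\<bar> \<le> C"
      using norm_bounded[of "sum t F" p] norm_bounded[of "t n" p] F(4) n(1) by auto
    have tr: "norm (apply_bcontfun (sum t (insert n F)) p)
        \<le> \<bar>apply_bcontfun (t n) p\<bar> + \<bar>apply_bcontfun (sum t F) p\<bar>"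
      using F(1) \<open>n \<notin> F\<close> by simp
    have "0 \<le> N * e" "Suc N * e = N * e + e"
      using e by (auto simp: algebra_simps)
    then show "norm (apply_bcontfun (sum t (insert n F)) p) \<le> C + Suc N * e"
      using tr ge P[of p] n(2)[of p] by (cases "p < P") linarith+
  qed
  then show ?case
    using F n(3) \<open>n \<notin> F\<close> by (intro exI[of _ "insert n F"]) auto
qed

text \<open>The sum of \<open>N\<close> late partial sums is again a combination of the
  \<open>x k\<close>, and its projection to the first \<open>m\<close> terms is \<open>N\<close>
  times the fixed \<open>m\<close>-term sum. The gliding hump and the basis constant bound this by
  \<open>M * (C + N * e)\<close>; divide by \<open>N\<close>, then let \<open>N\<close> grow and
  \<open>e\<close> shrink.\<close>

lemma weakly_null_partial_sums_eq_0:
  fixes x :: "nat \<Rightarrow> linf"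
  assumes x: "\<And>k. x k \<in> c0"
    and M: "M > 0" "\<And>\<alpha> m n. n \<le> m \<Longrightarrow> norm (partial_sum x \<alpha> n) \<le> M * norm (partial_sum x \<alpha> m)"
    and lim: "\<And>p. (\<lambda>n. apply_bcontfun (partial_sum x \<gamma> n) p) \<longlonglongrightarrow> 0"
    and bd: "\<forall>\<^sub>F n in sequentially. norm (partial_sum x \<gamma> n) \<le> C"
  shows "partial_sum x \<gamma> m = 0"
proof -
  let ?t = "partial_sum x \<gamma>"
  have c0: "?t n \<in> c0" for n
    using x by (intro subspace_sum subspace_scale subspace_c0)
  have le: "N * norm (?t m) \<le> M * (C + N * e)" if e: "e > 0" for N :: nat and e :: real
  proof -
    obtain F where F: "finite F" "card F = N" "F \<subseteq> {m..}" "norm (sum ?t F) \<le> C + N * e"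
      using gliding_hump_c0[OF c0 lim bd e] by blast
    \<comment> \<open>The coefficients of \<open>sum ?t F\<close>: \<gamma> at \<open>k\<close>,
      counted once for each \<open>n\<close> in \<open>F\<close> beyond \<open>k\<close>.\<close>
    define \<delta> where "\<delta> k = (\<Sum>n\<in>F. if k < n then \<gamma> k else 0)" for k
    have \<delta>: "partial_sum x \<delta> l = (\<Sum>n\<in>F. ?t (min n l))" for l
    proof -
      have "partial_sum x \<delta> l = (\<Sum>n\<in>F. \<Sum>k<l. (if k < n then \<gamma> k else 0) *\<^sub>R x k)"
        unfolding \<delta>_def scaleR_sum_left by (rule sum.swap)
      also have "\<dots> = (\<Sum>n\<in>F. ?t (min n l))"
        by (intro sum.cong refl sum.mono_neutral_cong_right) auto
      finally show ?thesis .
    qed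
    \<comment> \<open>At length \<open>L\<close> no member of \<open>F\<close> is cut off; at length
      \<open>m\<close> every one is cut down to \<open>m\<close>. Inserting \<open>m\<close> gives
      \<open>m \<le> L\<close>, as the basis inequality requires.\<close>
    define L where "L = Max (insert m F)"
    have L: "m \<le> L" "\<And>n. n \<in> F \<Longrightarrow> n \<le> L"
      using F(1) by (auto simp: L_def)
    have "partial_sum x \<delta> m = (\<Sum>n\<in>F. ?t m)"
      unfolding \<delta> using F(3) by (intro sum.cong) (auto simp: min_absorb2)
    then have "norm (partial_sum x \<delta> m) = N * norm (?t m)"
      using F(2) by (simp add: sum_constant_scaleR)
    moreover have "partial_sum x \<delta> L = sum ?t F"
      unfolding \<delta> using L(2) by (intro sum.cong) (auto simp: min_absorb1)
    ultimately have "N * norm (?t m) \<le> M * norm (sum ?t F)"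
      using M(2)[OF L(1), of \<delta>] by simp
    also have "\<dots> \<le> M * (C + N * e)"
      using F(4) M(1) by (intro mult_left_mono) auto
    finally show ?thesis .
  qed
  have small: "norm (?t m) \<le> M * e" if "e > 0" for e
  proof (rule ccontr)
    assume "\<not> ?thesis"
    \<comment> \<open>A positive gap, multiplied by a large \<open>N\<close>, would exceed the fixed
      quantity \<open>M * C\<close>.\<close>
    then obtain N :: nat where "M * C < N * (norm (?t m) - M * e)"
      using reals_Archimedean3[of "norm (?t m) - M * e"] by auto
    with le[OF that, of N] show False
      by (simp add: algebra_simps)
  qed
  have "norm (?t m) \<le> 0"
  proof (rule field_le_epsilon)
    fix e :: real assume "e > 0"
    with small[of "e / M"] M(1) show "norm (?t m) \<le> 0 + e"
      by simp
  qed
  then show ?thesis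
    by simp
qed

section \<open>The bibasic inequality and uniqueness of order expansions\<close>

theorem theorem9p5:
  fixes x :: "nat \<Rightarrow> linf"
  assumes "\<And>k. x k \<in> c0"
    and "schauder_basic x"
  shows "bibasic x \<and> unique_order_expansions x"
proof
  obtain M where M: "M \<ge> 1"
    "\<And>\<alpha> m n. n \<le> m \<Longrightarrow> norm (partial_sum x \<alpha> n) \<le> M * norm (partial_sum x \<alpha> m)"
    using schauder_basic_basis_constant[OF assms(2)] by blast
  have nz: "x k \<noteq> 0" for k
    using assms(2) unfolding schauder_basic_def
    by (rule schauder_basis_nonzero) (simp add: subspace_closure subspace_0)
  have "norm (Sup_fin ((\<lambda>n. \<bar>partial_sum x \<alpha> n\<bar>) ` {1..m})) \<le> M * norm (partial_sum x \<alpha> m)"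
    if "m \<ge> 1" for m \<alpha>
  proof -
    have "norm f \<le> M * norm (partial_sum x \<alpha> m)" if "f \<in> partial_sum x \<alpha> ` {1..m}" for f
      using that M(2) by auto
    from norm_Sup_fin_abs_le[of "partial_sum x \<alpha> ` {1..m}", OF _ _ this] show ?thesis
      using that by (simp add: image_image)
  qed
  with nz M(1) show "bibasic x"
    unfolding bibasic_def by blast
  show "unique_order_expansions x"
    unfolding unique_order_expansions_def
  proof (intro allI impI)
    fix \<alpha> \<beta> v k
    assume a: "order_converges_to (partial_sum x \<alpha>) v" and b: "order_converges_to (partial_sum x \<beta>) v"
    \<comment> \<open>In the difference the common limit \<open>v\<close>, which may lie outside
      \<open>c0\<close>, cancels, leaving partial sums in \<open>c0\<close> that tend to 0
      coordinatewise.\<close>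
    let ?\<gamma> = "\<lambda>k. \<alpha> k - \<beta> k"
    obtain A B where "\<forall>\<^sub>F n in sequentially. norm (partial_sum x \<alpha> n - v) \<le> A"
      "\<forall>\<^sub>F n in sequentially. norm (partial_sum x \<beta> n - v) \<le> B"
      using order_converges_to_bounded[OF a] order_converges_to_bounded[OF b] by blast
    then have bd: "\<forall>\<^sub>F n in sequentially. norm (partial_sum x ?\<gamma> n) \<le> A + B"
    proof eventually_elim
      case (elim n)
      have "norm ((partial_sum x \<alpha> n - v) - (partial_sum x \<beta> n - v)) \<le> A + B"
        by (rule order_trans[OF norm_triangle_ineq4 add_mono[OF elim]])
      then show ?case
        unfolding partial_sum_diff by simp
    qed
    have lim: "(\<lambda>n. apply_bcontfun (partial_sum x ?\<gamma> n) p) \<longlonglongrightarrow> 0" for p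
      unfolding partial_sum_diff
      using tendsto_diff[OF order_converges_to_coordinatewise[OF a, of p]
          order_converges_to_coordinatewise[OF b, of p]] by simp
    have "M > 0"
      using M(1) by simp
    from weakly_null_partial_sums_eq_0[OF assms(1) this M(2) lim bd]
    \<comment> \<open>A term is the difference of two consecutive partial sums, both of which
      vanish.\<close>
    have "?\<gamma> k *\<^sub>R x k = 0"
      using sum.lessThan_Suc[of "\<lambda>k. ?\<gamma> k *\<^sub>R x k" k] by simp
    with nz show "\<alpha> k = \<beta> k"
      by simp
  qed
qed

end
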